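(* Let $(d_n)_{n\ge 1}$ be an arbitrary sequence of complex numbers, and let $(a_n)_{n\ge 0}$ be defined by $a_0=1$, $a_1=1$ and $a_{n+1}=a_n+d_n\, a_{n-1}$ for all integers $n\ge 1$. Then for every integer $n\ge 1$, $$a_{n+1} = 1 + \sum_{p=1}^{\lfloor (n+1)/2\rfloor}\ \sum_{q=1}^{M(n,p)} G(n,p,q),$$ where $$M(n,p)=\prod_{r=1}^{p}(n-2p+2r)=\prod_{l=0}^{p-1}(n-2l),$$ $$G(n,p,q)=d_{g(1,n,p,q)}\cdot\prod_{m=2}^{p}\Big[d_{g(m,n,p,q)}\cdot H\big(g(m,n,p,q)-g(m-1,n,p,q)-2\big)\Big],$$ $$g(1,n,p,q)=q-(n-2p+2)\left\lfloor \frac{q-1}{n-2p+2}\right\rfloor,$$ and, for $2\le m\le p$, $$g(m,n,p,q)=1+\left\lfloor \frac{q-1}{\prod_{j=1}^{m-1}(n-2p+2j)}\right\rfloor-(n-2p+2m)\left\lfloor \frac{q-1}{\prod_{j=1}^{m}(n-2p+2j)}\right\rfloor .$$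
   Context: $\lfloor x\rfloor=\max\{m\in\mathbb{Z}: m\le x\}$ is the floor function. $H$ is the unit step function: $H(x)=1$ for $x\ge 0$ and $H(x)=0$ for $x<0$. An empty product (e.g. $\prod_{m=2}^{p}$ with $p=1$) equals $1$. *)

theory Defs
  imports Complex_Main
begin

definition unit_step :: "real \<Rightarrow> real" where
  "unit_step x = (if x \<ge> 0 then 1 else 0)"

text \<open>
  The expression \<open>n - 2p + 2r\<close> is computed in the integers, so that subtraction does not
  truncate. In the range \<open>1 \<le> p \<le> \<lfloor>(n+1)/2\<rfloor>\<close>, \<open>r \<ge> 1\<close> it is positive.
\<close>

definition radix :: "nat \<Rightarrow> nat \<Rightarrow> nat \<Rightarrow> int" where
  "radix n p r = int n - 2 * int p + 2 * int r"

definition M_bound :: "nat \<Rightarrow> nat \<Rightarrow> int" where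
  "M_bound n p = (\<Prod>r=1..p. radix n p r)"

lemma M_bound_alt: "M_bound n p = (\<Prod>l<p. int n - 2 * int l)"
  unfolding M_bound_def radix_def
  by (rule prod.reindex_bij_witness[where i = "\<lambda>l. p - l" and j = "\<lambda>r. p - r"])
    (auto simp: of_nat_diff)

text \<open>Only \<open>m \<ge> 1\<close> is meaningful below; the value at \<open>m = 0\<close> is never used.\<close>

definition g_index :: "nat \<Rightarrow> nat \<Rightarrow> nat \<Rightarrow> int \<Rightarrow> int" where
  "g_index m n p q =
    (if m = 1
     then q - radix n p 1 * \<lfloor>real_of_int (q - 1) / real_of_int (radix n p 1)\<rfloor>
     else 1 + \<lfloor>real_of_int (q - 1) / real_of_int (\<Prod>j=1..m-1. radix n p j)\<rfloor>
            - radix n p m * \<lfloor>real_of_int (q - 1) / real_of_int (\<Prod>j=1..m. radix n p j)\<rfloor>)"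

text \<open>
  The sequence \<open>d\<close> is indexed by \<open>nat\<close>. The conversion \<open>nat\<close> loses nothing here, since
  all the indices \<open>g_index m n p q\<close> with \<open>1 \<le> m \<le> p\<close> and \<open>1 \<le> q \<le> M_bound n p\<close>
  are at least 1.
\<close>

definition G_term :: "(nat \<Rightarrow> complex) \<Rightarrow> nat \<Rightarrow> nat \<Rightarrow> int \<Rightarrow> complex" where
  "G_term d n p q =
    d (nat (g_index 1 n p q)) *
    (\<Prod>m=2..p. d (nat (g_index m n p q)) *
       complex_of_real (unit_step (real_of_int (g_index m n p q - g_index (m - 1) n p q - 2))))"

end

theory Submission
  imports Defs
begin

text \<open>
  Unfolding the recurrence, \<open>a (n + 1)\<close> is the sum of \<open>\<Prod>i\<in>S. d i\<close> over all
  \<open>S \<subseteq> {1..n}\<close> without two consecutive elements. If \<open>S\<close> consists of \<open>k\<^sub>1 < \<dots> < k\<^sub>p\<close>,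
  then \<open>k\<^sub>m \<le> n - 2p + 2m\<close>, so \<open>(k\<^sub>1 - 1, \<dots>, k\<^sub>p - 1)\<close> is the digit sequence of a unique
  number \<open>q - 1\<close> in the mixed radix system with radices \<open>n - 2p + 2m\<close>. The indices
  \<open>g_index m n p q\<close> are these digits plus one, and the unit steps discard exactly the digit
  sequences that do not come from such a set.
\<close>

text \<open>
  Sum of \<open>\<Prod>i\<in>S. d i\<close> over the \<open>p\<close>-element sets \<open>S \<subseteq> {1..n}\<close> without consecutive elements;
  the last equation distinguishes whether \<open>Suc n \<in> S\<close>, and the truncation of \<open>n - 1\<close>
  at \<open>n = 0\<close> is harmless.
\<close>

fun sparse_sum :: "(nat \<Rightarrow> 'a::comm_semiring_1) \<Rightarrow> nat \<Rightarrow> nat \<Rightarrow> 'a" where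
  "sparse_sum d 0 n = 1"
| "sparse_sum d (Suc p) 0 = 0"
| "sparse_sum d (Suc p) (Suc n) = sparse_sum d (Suc p) n + d (Suc n) * sparse_sum d p (n - 1)"

text \<open>Sorts the sets by their largest element \<open>Suc y\<close>; the other elements then
  lie in \<open>{1..y - 1}\<close>.\<close>

lemma sparse_sum_Suc: "sparse_sum d (Suc p) n = (\<Sum>y<n. d (Suc y) * sparse_sum d p (y - 1))"
  by (induction n) auto

text \<open>The \<open>p\<close> elements and the \<open>p - 1\<close> gaps between them need at
  least \<open>2 * p - 1\<close> places.\<close>

lemma sparse_sum_eq_0: "n + 1 < 2 * p \<Longrightarrow> sparse_sum d p n = 0"
proof (induction d p n rule: sparse_sum.induct)
  case (3 d p n)
  from "3.prems" have "n + 1 < 2 * Suc p" "n - 1 + 1 < 2 * p" by presburger+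
  then show ?case using "3.IH" by simp
qed simp_all

lemma recurrence_eq_sum_sparse_sum:
  fixes a d :: "nat \<Rightarrow> 'a::comm_semiring_1"
  assumes a0: "a 0 = 1" and a1: "a 1 = 1"
    and rec: "\<And>n. n \<ge> 1 \<Longrightarrow> a (n + 1) = a n + d n * a (n - 1)"
  shows "a (n + 1) = (\<Sum>p\<le>n. sparse_sum d p n)"
proof (induction n rule: less_induct)
  case (less n)
  show ?case
  proof (cases n)
    case 0
    then show ?thesis using a1 by simp
  next
    case (Suc k)
    have "(\<Sum>p\<le>Suc k. sparse_sum d p (Suc k))
        = 1 + (\<Sum>p\<le>k. sparse_sum d (Suc p) (Suc k))"
      by (simp add: sum.atMost_Suc_shift del: sum.atMost_Suc)
    also have "\<dots> = (1 + (\<Sum>p\<le>k. sparse_sum d (Suc p) k))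
        + d (Suc k) * (\<Sum>p\<le>k. sparse_sum d p (k - 1))"
      by (simp add: sum.distrib sum_distrib_left add.assoc)
    also have "1 + (\<Sum>p\<le>k. sparse_sum d (Suc p) k) = (\<Sum>p\<le>Suc k. sparse_sum d p k)"
      by (simp add: sum.atMost_Suc_shift del: sum.atMost_Suc)
    \<comment> \<open>The top summand \<open>p = Suc k\<close> vanishes, which leaves the range of
      the induction hypothesis.\<close>
    also have "\<dots> = a (k + 1)"
      using less[of k] Suc by (simp add: sparse_sum_eq_0)
    also have "(\<Sum>p\<le>k. sparse_sum d p (k - 1)) = a k"
    proof (cases k)
      case 0
      then show ?thesis using a0 by simp
    next
      case (Suc j)
      then show ?thesis using less[of j] \<open>n = Suc k\<close> by (simp add: sparse_sum_eq_0)
    qed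
    finally show ?thesis using rec[of "Suc k"] Suc by simp
  qed
qed

text \<open>Digits are counted from position 1 and shifted by one, so they range over \<open>{1..R m}\<close>.\<close>

definition mixed_digit :: "(nat \<Rightarrow> nat) \<Rightarrow> nat \<Rightarrow> nat \<Rightarrow> nat" where
  "mixed_digit R m x = Suc (x div (\<Prod>j=1..<m. R j) mod R m)"

text \<open>The product up to \<open>p\<close> is a multiple of \<open>R m\<close> times the place
  value of digit \<open>m\<close>, so the quotient changes by a multiple of
  \<open>R m\<close>.\<close>

lemma mixed_digit_add_mult:
  assumes pos: "\<And>j. j \<ge> 1 \<Longrightarrow> R j > 0" and m: "1 \<le> m" "m \<le> p"
  shows "mixed_digit R m (x + y * (\<Prod>j=1..p. R j)) = mixed_digit R m x"
proof -
  have "(\<Prod>j=1..p. R j) = (\<Prod>j=1..m. R j) * (\<Prod>j=Suc m..p. R j)"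
    using m prod.ub_add_nat[of 1 m R "p - m"] by simp
  also have "(\<Prod>j=1..m. R j) = (\<Prod>j=1..<m. R j) * R m"
    using m(1) by (simp add: prod.last_plus mult.commute)
  finally obtain k where k: "(\<Prod>j=1..p. R j) = (\<Prod>j=1..<m. R j) * (R m * k)"
    by (metis mult.assoc)
  have "(\<Prod>j=1..<m. R j) \<noteq> 0" using pos by force
  then have "(x + y * (\<Prod>j=1..p. R j)) div (\<Prod>j=1..<m. R j)
      = x div (\<Prod>j=1..<m. R j) + R m * (k * y)"
    unfolding k using div_mult_self2[of "\<Prod>j=1..<m. R j" x "R m * (k * y)"]
    by (simp add: ac_simps)
  then show ?thesis by (simp add: mixed_digit_def)
qed

lemma mixed_digit_last:
  assumes "x < (\<Prod>j=1..p. R j)" "y < R (Suc p)"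
  shows "mixed_digit R (Suc p) (x + y * (\<Prod>j=1..p. R j)) = Suc y"
proof -
  have "(x + y * (\<Prod>j=1..p. R j)) div (\<Prod>j=1..p. R j) = y"
    using assms(1) by (metis div_less div_mult_self3 add_0 add.commute not_less0)
  then show ?thesis
    using assms(2) by (simp add: mixed_digit_def atLeastLessThanSuc_atLeastAtMost)
qed

text \<open>The radices are a sequence \<open>R\<close> independent of \<open>p\<close>: those given
  by \<open>radix\<close> shift with \<open>p\<close>, which would obstruct an induction on the
  number of digits.\<close>

definition digit_weight ::
    "(nat \<Rightarrow> 'a::comm_semiring_1) \<Rightarrow> (nat \<Rightarrow> nat) \<Rightarrow> nat \<Rightarrow> nat \<Rightarrow> 'a" where
  "digit_weight d R p x = d (mixed_digit R 1 x) *
     (\<Prod>m=2..p. d (mixed_digit R m x) * of_bool (mixed_digit R (m - 1) x + 2 \<le> mixed_digit R m x))"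

lemma digit_weight_Suc:
  assumes pos: "\<And>j. j \<ge> 1 \<Longrightarrow> R j > 0" and p: "p \<ge> 1"
    and x: "x < (\<Prod>j=1..p. R j)" and y: "y < R (Suc p)"
  shows "digit_weight d R (Suc p) (x + y * (\<Prod>j=1..p. R j)) =
    digit_weight d R p x * (d (Suc y) * of_bool (mixed_digit R p x + 2 \<le> Suc y))"
proof -
  let ?z = "x + y * (\<Prod>j=1..p. R j)"
  have *: "mixed_digit R m ?z = mixed_digit R m x" if "1 \<le> m" "m \<le> p" for m
    using mixed_digit_add_mult[of R, OF pos that] .
  have "digit_weight d R (Suc p) ?z = digit_weight d R p ?z *
      (d (Suc y) * of_bool (mixed_digit R p x + 2 \<le> Suc y))"
    using p *[of p] mixed_digit_last[OF x y]
    by (simp add: digit_weight_def mult.assoc)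
  also have "digit_weight d R p ?z = digit_weight d R p x"
    unfolding digit_weight_def using p
    by (intro arg_cong2[where f = "(*)"] prod.cong) (auto simp: * simp del: One_nat_def)
  finally show ?thesis .
qed

text \<open>
  The bound \<open>t\<close> on the last digit makes the induction on \<open>p\<close> work: the last factor of the weight
  bounds the digit before it.
\<close>

lemma sum_digit_weight_last_digit_le:
  assumes pos: "\<And>j. j \<ge> 1 \<Longrightarrow> R j > 0" and step: "\<And>j. j \<ge> 1 \<Longrightarrow> R (Suc j) \<le> R j + 2"
    and p: "p \<ge> 1" and t: "t \<le> R p"
  shows "(\<Sum>x<(\<Prod>j=1..p. R j). digit_weight d R p x * of_bool (mixed_digit R p x \<le> t))
    = sparse_sum d p t"
  using p t
proof (induction p arbitrary: t rule: nat_induct_at_least)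
  case base
  have "(\<Sum>x<R 1. digit_weight d R 1 x * of_bool (mixed_digit R 1 x \<le> t))
      = (\<Sum>x<R 1. if x < t then d (Suc x) else 0)"
    by (intro sum.cong) (auto simp: digit_weight_def mixed_digit_def)
  also have "\<dots> = (\<Sum>x<t. d (Suc x))"
    using base by (intro sum.mono_neutral_cong_right) auto
  finally show ?case using sparse_sum_Suc[of d 0 t] by simp
next
  case (Suc p)
  let ?P = "\<Prod>j=1..p. R j"
  let ?f = "\<lambda>x. digit_weight d R (Suc p) x * of_bool (mixed_digit R (Suc p) x \<le> t)"
  have inner: "(\<Sum>x<?P. ?f (x + y * ?P))
      = (if y < t then d (Suc y) * sparse_sum d p (y - 1) else 0)" if y: "y < R (Suc p)" for y
  proof -
    \<comment> \<open>Since radices grow by at most 2 per position, \<open>y - 1\<close> is an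
      admissible bound in the induction hypothesis.\<close>
    have le: "y - 1 \<le> R p" using y step[of p] Suc.hyps by simp
    have "(\<Sum>x<?P. ?f (x + y * ?P)) = (\<Sum>x<?P. (if y < t then d (Suc y) else 0) *
        (digit_weight d R p x * of_bool (mixed_digit R p x \<le> y - 1)))"
    proof (intro sum.cong refl)
      fix x assume "x \<in> {..<?P}"
      then have x: "x < ?P" by simp
      \<comment> \<open>Digits are at least 1, so both conditions below fail at
        \<open>y = 0\<close>, where \<open>y - 1\<close> truncates.\<close>
      have "mixed_digit R p x \<ge> 1" by (simp add: mixed_digit_def)
      then have "mixed_digit R p x + 2 \<le> Suc y \<longleftrightarrow> mixed_digit R p x \<le> y - 1" by linarith
      then show "?f (x + y * ?P) = (if y < t then d (Suc y) else 0) *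
        (digit_weight d R p x * of_bool (mixed_digit R p x \<le> y - 1))"
        using digit_weight_Suc[of R p x y d, OF pos Suc.hyps x y] mixed_digit_last[OF x y]
        by (simp add: Suc_le_eq mult.commute)
    qed
    also have "\<dots> = (if y < t then d (Suc y) else 0) * sparse_sum d p (y - 1)"
      by (simp only: sum_distrib_left[symmetric] Suc.IH[OF le])
    finally show ?thesis by simp
  qed
  \<comment> \<open>The range is cut into blocks of length \<open>?P\<close>, one for each leading
    digit \<open>Suc y\<close>.\<close>
  have "(\<Sum>x<(\<Prod>j=1..Suc p. R j). ?f x) = (\<Sum>x<R (Suc p) * ?P. ?f x)"
    by (simp add: mult.commute)
  also have "\<dots> = (\<Sum>y<R (Suc p). \<Sum>x=y * ?P..<y * ?P + ?P. ?f x)"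
    by (simp only: sum.nat_group)
  also have "\<dots> = (\<Sum>y<R (Suc p). \<Sum>x<?P. ?f (x + y * ?P))"
  proof (rule sum.cong[OF refl])
    fix y
    show "(\<Sum>x=y * ?P..<y * ?P + ?P. ?f x) = (\<Sum>x<?P. ?f (x + y * ?P))"
      using sum.shift_bounds_nat_ivl[of ?f 0 "y * ?P" ?P]
      by (simp add: add.commute lessThan_atLeast0)
  qed
  also have "\<dots> = (\<Sum>y<R (Suc p). if y < t then d (Suc y) * sparse_sum d p (y - 1) else 0)"
    using inner by (intro sum.cong) auto
  also have "\<dots> = (\<Sum>y<t. d (Suc y) * sparse_sum d p (y - 1))"
    using Suc.prems by (intro sum.mono_neutral_cong_right) auto
  finally show ?case by (simp only: sparse_sum_Suc)
qed

lemma sum_digit_weight: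
  assumes pos: "\<And>j. j \<ge> 1 \<Longrightarrow> R j > 0" and step: "\<And>j. j \<ge> 1 \<Longrightarrow> R (Suc j) \<le> R j + 2"
    and p: "p \<ge> 1"
  shows "(\<Sum>x<(\<Prod>j=1..p. R j). digit_weight d R p x) = sparse_sum d p (R p)"
proof -
  have "mixed_digit R p x \<le> R p" for x
    using pos[OF p] by (simp add: mixed_digit_def Suc_le_eq)
  then show ?thesis
    using sum_digit_weight_last_digit_le[of R p "R p" d, OF pos step p order_refl] by simp
qed

text \<open>The difference of floors is a remainder, \<open>a mod b = a - b * (a div b)\<close>,
  because dividing by the longer product amounts to dividing by the shorter one and then by
  \<open>R m\<close>.\<close>

lemma g_index_eq_mixed_digit:
  assumes R: "\<And>j. j \<ge> 1 \<Longrightarrow> radix n p j = int (R j)" and m: "m \<ge> 1"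
  shows "g_index m n p (int x + 1) = int (mixed_digit R m x)"
proof -
  have prod: "(\<Prod>j=1..k. radix n p j) = int (\<Prod>j=1..k. R j)" for k
    using R by simp
  have floor: "\<lfloor>real_of_int (int x) / real_of_int (int k)\<rfloor> = int (x div k)" for k
    by (simp add: floor_divide_of_nat_eq)
  show ?thesis
  proof (cases "m = 1")
    case True
    have "int x = int (R 1) * int (x div R 1) + int (x mod R 1)"
      by (simp only: of_nat_add[symmetric] of_nat_mult[symmetric] mult_div_mod_eq)
    then show ?thesis
      using True floor[of "R 1"] R[of 1] by (simp add: g_index_def mixed_digit_def)
  next
    case False
    then have iv: "{1..<m} = {1..m - 1}" using m by auto
    let ?P = "\<Prod>j=1..m - 1. R j"
    have P: "(\<Prod>j=1..m. R j) = ?P * R m"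
      using m by (cases m) simp_all
    have "int (x div ?P) = int (R m) * int (x div (?P * R m)) + int (x div ?P mod R m)"
      unfolding div_mult2_eq
      by (simp only: of_nat_add[symmetric] of_nat_mult[symmetric] mult_div_mod_eq)
    moreover have "g_index m n p (int x + 1)
        = 1 + int (x div ?P) - int (R m) * int (x div (?P * R m))"
      using False R[OF m] unfolding g_index_def prod P
      by (simp only: floor add_diff_cancel_right' if_False)
    ultimately show ?thesis by (simp add: mixed_digit_def iv del: One_nat_def)
  qed
qed

lemma G_term_eq_digit_weight:
  assumes R: "\<And>j. j \<ge> 1 \<Longrightarrow> radix n p j = int (R j)"
  shows "G_term d n p (int x + 1) = digit_weight d R p x"
proof -
  have g: "g_index m n p (int x + 1) = int (mixed_digit R m x)" if "m \<ge> 1" for m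
    using g_index_eq_mixed_digit[of n p R m x] R that by blast
  have "d (nat (g_index m n p (int x + 1))) * complex_of_real (unit_step
          (real_of_int (g_index m n p (int x + 1) - g_index (m - 1) n p (int x + 1) - 2)))
      = d (mixed_digit R m x) * of_bool (mixed_digit R (m - 1) x + 2 \<le> mixed_digit R m x)"
    if "m \<in> {2..p}" for m
  proof -
    have "m \<ge> 1" "m - 1 \<ge> 1" using that by auto
    then show ?thesis by (auto simp: g unit_step_def simp del: One_nat_def)
  qed
  then have "(\<Prod>m=2..p. d (nat (g_index m n p (int x + 1))) * complex_of_real (unit_step
          (real_of_int (g_index m n p (int x + 1) - g_index (m - 1) n p (int x + 1) - 2))))
      = (\<Prod>m=2..p. d (mixed_digit R m x)
          * of_bool (mixed_digit R (m - 1) x + 2 \<le> mixed_digit R m x))"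
    by (rule prod.cong[OF refl])
  then show ?thesis
    unfolding G_term_def digit_weight_def by (simp only: g[of 1, OF order_refl] nat_int)
qed

lemma sum_G_term:
  assumes p: "p \<ge> 1" "2 * p \<le> n + 1"
  shows "(\<Sum>q=1..M_bound n p. G_term d n p q) = sparse_sum d p n"
proof -
  \<comment> \<open>By \<open>2 * p \<le> n + 1\<close>, every \<open>R j\<close> with
    \<open>j \<ge> 1\<close> is positive and untruncated; moreover \<open>R p = n\<close>.\<close>
  define R where "R j = n + 2 * j - 2 * p" for j
  have R: "radix n p j = int (R j)" if "j \<ge> 1" for j
    using that p by (simp add: radix_def R_def)
  have M: "M_bound n p = int (\<Prod>j=1..p. R j)"
    using R by (simp add: M_bound_def)
  have "(\<Sum>q=1..M_bound n p. G_term d n p q)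
      = (\<Sum>x<(\<Prod>j=1..p. R j). digit_weight d R p x)"
    unfolding M
    by (rule sum.reindex_bij_witness[where i = "\<lambda>x. int x + 1" and j = "\<lambda>q. nat (q - 1)"])
      (auto simp del: of_nat_prod simp flip: G_term_eq_digit_weight[of n p R, OF R])
  also have "\<dots> = sparse_sum d p (R p)"
    using p by (intro sum_digit_weight) (auto simp: R_def)
  finally show ?thesis by (simp add: R_def)
qed

theorem mainTheorem1:
  fixes d a :: "nat \<Rightarrow> complex"
  assumes "a 0 = 1"
    and "a 1 = 1"
    and "\<And>n. n \<ge> 1 \<Longrightarrow> a (n + 1) = a n + d n * a (n - 1)"
  shows "\<forall>n\<ge>1. a (n + 1) =
    1 + (\<Sum>p=1..nat \<lfloor>(real n + 1) / 2\<rfloor>. \<Sum>q=1..M_bound n p. G_term d n p q)"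
proof (intro allI impI)
  fix n :: nat assume n: "n \<ge> 1"
  have N: "nat \<lfloor>(real n + 1) / 2\<rfloor> = (n + 1) div 2"
    using floor_divide_of_nat_eq[of "n + 1" 2, where ?'a = real] by (simp add: add.commute)
  have "a (n + 1) = (\<Sum>p\<le>n. sparse_sum d p n)"
    by (rule recurrence_eq_sum_sparse_sum[OF assms])
  also have "\<dots> = 1 + (\<Sum>p=1..n. sparse_sum d p n)"
    by (simp add: atMost_atLeast0 sum.atLeast_Suc_atMost)
  \<comment> \<open>Sizes above \<open>(n + 1) div 2\<close> contribute 0, as too few places are
    available.\<close>
  also have "(\<Sum>p=1..n. sparse_sum d p n) = (\<Sum>p=1..(n + 1) div 2. sparse_sum d p n)"
    using n by (intro sum.mono_neutral_right) (auto intro: sparse_sum_eq_0)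
  also have "\<dots> = (\<Sum>p=1..(n + 1) div 2. \<Sum>q=1..M_bound n p. G_term d n p q)"
    by (intro sum.cong refl sum_G_term[symmetric]) auto
  finally show "a (n + 1) =
      1 + (\<Sum>p=1..nat \<lfloor>(real n + 1) / 2\<rfloor>. \<Sum>q=1..M_bound n p. G_term d n p q)"
    by (simp only: N)
qed

end
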